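(* Let $g$ be a derivator, $f\in\operatorname{UC}_g([a,b],\mathbb R)$ and $x,y\in[a,b]$ with $x<y$. Suppose $f(x)f(y)<0$. Then $f$ has a root (of type I or type II) in $[x,y)^g_+$.
   Context: A derivator is a left-continuous nondecreasing function $g:\mathbb R\to\mathbb R$. $g(t^+)$ is the right-hand limit and $D_g=\{t\in\mathbb R:g(t^+)>g(t)\}$. For real $a<b$, $[a,b]_+$ is the disjoint union of $[a,b]$ and a formal copy $\{t^+:t\in D_g\cap[a,b)\}$; $g$ is extended to it by letting $g(t^+)$ be the right-hand limit of $g$ at $t$. $\operatorname{UC}_g([a,b],\mathbb R)$ is the space of functions $f:[a,b]\to\mathbb R$ such that for every $\varepsilon>0$ there is $\delta>0$ with $|f(u)-f(v)|<\varepsilon$ whenever $u,v\in[a,b]$, $|g(u)-g(v)|<\delta$. Such $f$ is extended to $[a,b]_+$ by $f(t^+)=\lim_{y\to t^+}f(y)$ (which exists). $[x,y)^g_+=\{z\in[a,b]_+:g(x)\le g(z)<g(y)\}$. $f$ has a root of type I at $t\in[a,b]_+$ if $f(t)=0$, and a root of type II at $t$ if $t\in D_g\cap[a,b)$ and $f(t)f(t^+)<0$. *)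

theory Defs
  imports "HOL-Analysis.Analysis"
begin

definition derivator :: "(real \<Rightarrow> real) \<Rightarrow> bool" where
  "derivator g \<longleftrightarrow> mono g \<and> (\<forall>t. continuous (at_left t) g)"

definition right_lim :: "(real \<Rightarrow> real) \<Rightarrow> real \<Rightarrow> real" where
  "right_lim h t = Lim (at_right t) h"

definition jump_set :: "(real \<Rightarrow> real) \<Rightarrow> real set" where
  "jump_set g = {t. right_lim g t > g t}"

text \<open>\<open>Pt t\<close> stands for the real number \<open>t\<close>, and \<open>RPt t\<close> for the formal point \<open>t\<^sup>+\<close>.\<close>

datatype ext_point = Pt real | RPt real

definition ext_interval :: "(real \<Rightarrow> real) \<Rightarrow> real \<Rightarrow> real \<Rightarrow> ext_point set" where
  "ext_interval g a b = Pt ` {a..b} \<union> RPt ` (jump_set g \<inter> {a..<b})"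

text \<open>The extension of a function to formal points. It is used for the derivator and for functions
  on \<open>{a..b}\<close>; in the latter case \<open>RPt t\<close> only occurs with \<open>a \<le> t < b\<close>, so that the
  right-hand limit does not depend on values outside \<open>{a..b}\<close>.\<close>

fun ext_fun :: "(real \<Rightarrow> real) \<Rightarrow> ext_point \<Rightarrow> real" where
  "ext_fun h (Pt t) = h t"
| "ext_fun h (RPt t) = right_lim h t"

text \<open>A function on \<open>{a..b}\<close> is represented by a total function whose values outside
  \<open>{a..b}\<close> are irrelevant.\<close>

definition UC :: "(real \<Rightarrow> real) \<Rightarrow> real \<Rightarrow> real \<Rightarrow> (real \<Rightarrow> real) set" where
  "UC g a b = {f. \<forall>\<epsilon>>0. \<exists>\<delta>>0. \<forall>u\<in>{a..b}. \<forall>v\<in>{a..b}.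
     \<bar>g u - g v\<bar> < \<delta> \<longrightarrow> \<bar>f u - f v\<bar> < \<epsilon>}"

definition ext_Ico :: "(real \<Rightarrow> real) \<Rightarrow> real \<Rightarrow> real \<Rightarrow> real \<Rightarrow> real \<Rightarrow> ext_point set" where
  "ext_Ico g a b x y = {z \<in> ext_interval g a b. g x \<le> ext_fun g z \<and> ext_fun g z < g y}"

definition root_type_I ::
  "(real \<Rightarrow> real) \<Rightarrow> real \<Rightarrow> real \<Rightarrow> (real \<Rightarrow> real) \<Rightarrow> ext_point \<Rightarrow> bool" where
  "root_type_I g a b f z \<longleftrightarrow> z \<in> ext_interval g a b \<and> ext_fun f z = 0"

definition root_type_II ::
  "(real \<Rightarrow> real) \<Rightarrow> real \<Rightarrow> real \<Rightarrow> (real \<Rightarrow> real) \<Rightarrow> ext_point \<Rightarrow> bool" where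
  "root_type_II g a b f z \<longleftrightarrow>
     (\<exists>t \<in> jump_set g \<inter> {a..<b}. z = Pt t \<and> ext_fun f (Pt t) * ext_fun f (RPt t) < 0)"

end

(* A function f in UC factors as psi o g with psi continuous on the closure of g ` {a..b}, so all
   one-sided limits of f are psi applied to those of g. Let s be the supremum of the points of
   {x..y} where f has the sign opposite to f y. By left continuity f s vanishes or has that opposite
   sign. In the latter case f(s+) vanishes or has the sign of f y, which makes s a jump and s or s+ a
   root. *)
theory Submission
  imports Defs
begin

text \<open>\<open>Lim\<close> says something about \<open>g\<close> only once convergence is known;
  by monotonicity the values to the right of \<open>t\<close> tend to their infimum.\<close>

lemma mono_tendsto_right_lim:
  fixes g :: "real \<Rightarrow> real"
  assumes "mono g"
  shows "(g \<longlongrightarrow> right_lim g t) (at_right t)"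
proof -
  have "(g \<longlongrightarrow> Inf (g ` ({t<..} \<inter> UNIV))) (at t within {t<..} \<inter> UNIV)"
    by (rule Lim_right_bound[where K = "g t"]) (use assms in \<open>auto simp: mono_def\<close>)
  then have "(g \<longlongrightarrow> Inf (g ` {t<..})) (at_right t)"
    by simp
  then show ?thesis
    unfolding right_lim_def by (metis tendsto_Lim trivial_limit_at_right_real)
qed

lemma right_lim_ge:
  assumes "mono g"
  shows "g t \<le> right_lim g t"
proof (rule tendsto_lowerbound[OF mono_tendsto_right_lim[OF assms]])
  show "\<forall>\<^sub>F u in at_right t. g t \<le> g u"
    using assms by (auto simp: eventually_at_filter mono_def)
qed simp

lemma right_lim_le:
  assumes "mono g" and "t < u"
  shows "right_lim g t \<le> g u"
proof (rule tendsto_upperbound[OF mono_tendsto_right_lim[OF assms(1)]])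
  show "\<forall>\<^sub>F v in at_right t. g v \<le> g u"
    using eventually_at_right_real[OF assms(2)]
    by eventually_elim (use assms in \<open>auto simp: mono_def\<close>)
qed simp

text \<open>\<open>f\<close> is constant on the fibres of \<open>g\<close>, so it descends to a
  function on the image, whose uniform continuity is exactly the \<open>UC\<close> condition. By
  completeness of the reals it extends to the closure, which is needed because one-sided limits of
  \<open>g\<close> may lie outside the image.\<close>

lemma UC_factorization:
  assumes "f \<in> UC g a b"
  obtains \<psi> where "continuous_on (closure (g ` {a..b})) \<psi>"
    and "\<And>t. t \<in> {a..b} \<Longrightarrow> f t = \<psi> (g t)"
proof -
  define \<phi> where "\<phi> v = f (inv_into {a..b} g v)" for v
  \<comment> \<open>Taking the gap between \<open>f u\<close> and \<open>f v\<close> as epsilon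
    would make it smaller than itself.\<close>
  have eq: "f u = f v" if "u \<in> {a..b}" "v \<in> {a..b}" "g u = g v" for u v
  proof (rule ccontr)
    assume "f u \<noteq> f v"
    then have "\<bar>f u - f v\<bar> > 0" by simp
    then obtain d where "d > 0" and
      d: "\<forall>u'\<in>{a..b}. \<forall>v'\<in>{a..b}. \<bar>g u' - g v'\<bar> < d \<longrightarrow> \<bar>f u' - f v'\<bar> < \<bar>f u - f v\<bar>"
      using assms unfolding UC_def by blast
    have "\<bar>f u - f v\<bar> < \<bar>f u - f v\<bar>"
      using d[rule_format, OF that(1,2)] that(3) \<open>d > 0\<close> by simp
    then show False by simp
  qed
  have \<phi>: "\<phi> (g t) = f t" if "t \<in> {a..b}" for t
    unfolding \<phi>_def using that by (intro eq inv_into_into f_inv_into_f imageI)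
  have "uniformly_continuous_on (g ` {a..b}) \<phi>"
    unfolding uniformly_continuous_on_def
  proof (intro allI impI)
    fix e :: real assume "e > 0"
    then obtain d where "d > 0"
      "\<forall>u\<in>{a..b}. \<forall>v\<in>{a..b}. \<bar>g u - g v\<bar> < d \<longrightarrow> \<bar>f u - f v\<bar> < e"
      using assms unfolding UC_def by blast
    then show "\<exists>d>0. \<forall>p\<in>g ` {a..b}. \<forall>q\<in>g ` {a..b}. dist q p < d \<longrightarrow> dist (\<phi> q) (\<phi> p) < e"
      by (intro exI[of _ d]) (auto simp: \<phi> dist_real_def)
  qed
  then obtain \<psi> where "uniformly_continuous_on (closure (g ` {a..b})) \<psi>"
    "\<And>v. v \<in> g ` {a..b} \<Longrightarrow> \<phi> v = \<psi> v"
    by (rule uniformly_continuous_on_extension_on_closure) blast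
  then show ?thesis
    by (metis that \<phi> imageI uniformly_continuous_imp_continuous)
qed

text \<open>The limit \<open>l\<close> lies in the closure of the image, where \<open>\<psi>\<close>
  is continuous. Applied below to left and right neighbourhoods of a point.\<close>

lemma tendsto_factorized:
  assumes cont: "continuous_on (closure (g ` S)) \<psi>"
    and fact: "\<And>t. t \<in> S \<Longrightarrow> f t = \<psi> (g t)"
    and lim: "(g \<longlongrightarrow> l) F" and ev: "\<forall>\<^sub>F t in F. t \<in> S" and "F \<noteq> bot"
  shows "(f \<longlongrightarrow> \<psi> l) F"
proof -
  have ev': "\<forall>\<^sub>F t in F. g t \<in> closure (g ` S)"
    using ev by eventually_elim (rule subsetD[OF closure_subset imageI])
  then have "l \<in> closure (g ` S)"
    using Lim_in_closed_set[OF closed_closure _ \<open>F \<noteq> bot\<close> lim] by blast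
  then have "((\<lambda>t. \<psi> (g t)) \<longlongrightarrow> \<psi> l) F"
    by (rule continuous_on_tendsto_compose[OF cont lim _ ev'])
  moreover have "\<forall>\<^sub>F t in F. f t = \<psi> (g t)"
    using ev by eventually_elim (rule fact)
  ultimately show ?thesis
    by (simp add: tendsto_cong)
qed

theorem proposition4p2:
  fixes g f :: "real \<Rightarrow> real" and a b x y :: real
  assumes "a < b"
    and "derivator g"
    and "f \<in> UC g a b"
    and "x \<in> {a..b}" and "y \<in> {a..b}" and "x < y"
    and "f x * f y < 0"
  shows "\<exists>z \<in> ext_Ico g a b x y. root_type_I g a b f z \<or> root_type_II g a b f z"
proof -
  have g: "mono g" and left: "\<And>t. (g \<longlongrightarrow> g t) (at_left t)"
    using \<open>derivator g\<close> by (auto simp: derivator_def continuous_within)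
  obtain \<psi> where \<psi>: "continuous_on (closure (g ` {a..b})) \<psi>"
    "\<And>t. t \<in> {a..b} \<Longrightarrow> f t = \<psi> (g t)"
    using UC_factorization[OF \<open>f \<in> UC g a b\<close>] by blast
  define S where "S = {t \<in> {x..y}. f t * f y < 0}"
  define s where "s = Sup S"
  have "x \<in> S" and bdd: "bdd_above S"
    using assms by (auto simp: S_def)
  have "x \<le> s"
    unfolding s_def by (rule cSup_upper[OF \<open>x \<in> S\<close> bdd])
  have "s \<le> y"
    unfolding s_def by (rule cSup_least) (use \<open>x \<in> S\<close> in \<open>auto simp: S_def\<close>)
  \<comment> \<open>Otherwise \<open>f\<close> would have the sign of \<open>f y\<close> at
    \<open>s\<close> and, by left continuity, on some interval \<open>(d, s)\<close>, so
    \<open>S\<close> would have no point above \<open>d\<close>. Here \<open>x < s\<close> keeps the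
    left neighbourhood inside \<open>{a..b}\<close>.\<close>
  have fs: "f s * f y \<le> 0"
  proof (rule ccontr)
    assume "\<not> f s * f y \<le> 0"
    then have pos: "f s * f y > 0" by simp
    with \<open>f x * f y < 0\<close> \<open>x \<le> s\<close> have "x < s"
      by (cases "x = s") auto
    have "\<forall>\<^sub>F t in at_left s. t \<in> {a..b}"
      using eventually_at_left_real[OF \<open>x < s\<close>]
      by eventually_elim (use assms \<open>s \<le> y\<close> in auto)
    then have "(f \<longlongrightarrow> f s) (at_left s)"
      using tendsto_factorized[OF \<psi> left] \<psi>(2)[of s] \<open>x \<le> s\<close> \<open>s \<le> y\<close> assms by simp
    then have "((\<lambda>t. f t * f y) \<longlongrightarrow> f s * f y) (at_left s)"
      by (intro tendsto_intros)
    then have "\<forall>\<^sub>F t in at_left s. f t * f y > 0"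
      using pos by (rule order_tendstoD(1))
    then obtain d where "d < s" and d: "\<And>t. d < t \<Longrightarrow> t < s \<Longrightarrow> f t * f y > 0"
      unfolding eventually_at_left_field by blast
    obtain t where "t \<in> S" "d < t"
      using less_cSupE[of d S] \<open>d < s\<close> \<open>x \<in> S\<close> unfolding s_def by blast
    moreover have "t \<le> s"
      unfolding s_def by (rule cSup_upper[OF \<open>t \<in> S\<close> bdd])
    ultimately show False
      using d[of t] pos by (cases "t = s") (auto simp: S_def)
  qed
  have "f y * f y > 0"
    using \<open>f x * f y < 0\<close> by (auto simp: zero_less_mult_iff mult_less_0_iff)
  with fs \<open>s \<le> y\<close> have "s < y"
    by (cases "s = y") auto
  have s: "s \<in> {a..<b}"
    using assms \<open>x \<le> s\<close> \<open>s < y\<close> by auto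
  have "g x \<le> g s" and "g s \<le> g y"
    using g \<open>x \<le> s\<close> \<open>s \<le> y\<close> by (auto simp: mono_def)
  have "\<forall>\<^sub>F t in at_right s. t \<in> {a..b}"
    using eventually_at_right_real[OF \<open>s < y\<close>]
    by eventually_elim (use assms s in auto)
  \<comment> \<open>This limit exists whether or not \<open>s\<close> is a jump, so it can be used
    to decide that question.\<close>
  then have lim: "(f \<longlongrightarrow> \<psi> (right_lim g s)) (at_right s)"
    by (intro tendsto_factorized[OF \<psi> mono_tendsto_right_lim[OF g]]) auto
  then have fr: "right_lim f s = \<psi> (right_lim g s)"
    unfolding right_lim_def by (simp add: tendsto_Lim)
  \<comment> \<open>Points strictly between \<open>s\<close> and \<open>y\<close> exceed the
    supremum and so lie outside \<open>S\<close>; the weak inequality survives the limit.\<close>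
  have fr_ge: "right_lim f s * f y \<ge> 0"
  proof (rule tendsto_lowerbound)
    show "((\<lambda>t. f t * f y) \<longlongrightarrow> right_lim f s * f y) (at_right s)"
      using lim unfolding fr by (intro tendsto_intros)
    show "\<forall>\<^sub>F t in at_right s. 0 \<le> f t * f y"
      using eventually_at_right_real[OF \<open>s < y\<close>]
    proof eventually_elim
      case (elim t)
      then have "t \<notin> S"
        using cSup_upper[OF _ bdd, of t] unfolding s_def by auto
      with elim \<open>x \<le> s\<close> show ?case
        by (auto simp: S_def)
    qed
  qed simp
  show ?thesis
  proof (cases "f s = 0")
    case True
    \<comment> \<open>Strictness at the upper end: equal values of \<open>g\<close> would give
      \<open>f s = f y\<close>, but \<open>f y\<close> is nonzero.\<close>
    then have "g s \<noteq> g y"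
      using \<psi>(2)[of s] \<psi>(2)[of y] s \<open>y \<in> {a..b}\<close> \<open>f y * f y > 0\<close> by auto
    with True \<open>g x \<le> g s\<close> \<open>g s \<le> g y\<close> s show ?thesis
      by (intro bexI[of _ "Pt s"])
        (auto simp: ext_Ico_def ext_interval_def root_type_I_def)
  next
    case False
    with fs \<open>f y * f y > 0\<close> have neg: "f s * f y < 0"
      by (auto simp: less_le)
    \<comment> \<open>Without a jump, \<open>right_lim f s\<close> would be
      \<open>\<psi> (g s) = f s\<close>, and \<open>neg\<close> would contradict
      \<open>fr_ge\<close>.\<close>
    with fr_ge fr \<psi>(2)[of s] s have "right_lim g s \<noteq> g s"
      by auto
    with right_lim_ge[OF g, of s] have jump: "g s < right_lim g s"
      by simp
    have le: "right_lim g s \<le> g y"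
      by (rule right_lim_le[OF g \<open>s < y\<close>])
    show ?thesis
    proof (cases "right_lim f s = 0")
      case True
      \<comment> \<open>The same argument at the formal point: \<open>\<psi>\<close> vanishes at
        \<open>right_lim g s\<close> but not at \<open>g y\<close>.\<close>
      then have "right_lim g s \<noteq> g y"
        using fr \<psi>(2)[of y] \<open>y \<in> {a..b}\<close> \<open>f y * f y > 0\<close> by auto
      with True jump le \<open>g x \<le> g s\<close> s show ?thesis
        by (intro bexI[of _ "RPt s"])
          (auto simp: ext_Ico_def ext_interval_def root_type_I_def jump_set_def)
    next
      case False
      \<comment> \<open>Now \<open>right_lim f s\<close> has the sign of \<open>f y\<close>,
        opposite to that of \<open>f s\<close>. The strict bound \<open>g s < g y\<close> comes from
        \<open>jump\<close> and \<open>le\<close>.\<close>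
      with fr_ge neg have "f s * right_lim f s < 0"
        by (auto simp: mult_less_0_iff zero_le_mult_iff)
      with jump le \<open>g x \<le> g s\<close> s show ?thesis
        by (intro bexI[of _ "Pt s"])
          (auto simp: ext_Ico_def ext_interval_def root_type_II_def jump_set_def)
    qed
  qed
qed

end
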